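(* Let $f\colon\mathbb{R}\to\mathbb{R}$ be convex and twice differentiable with $C=\{x\in\mathbb{R}: f(x)\le 0\}\ne\varnothing$, let $L>0$ and $\rho>0$, suppose that $f'$ is Lipschitz continuous with constant $L$ and that $\inf f(\mathbb{R})\ge-\rho$, and set $\theta(x)=\frac{|f'(x)|^2}{2L}-\rho$. Let $Z\colon\mathbb{R}\to\mathbb{R}$ be the Yamagishi–Yamada operator of $f$ (see context). Then for every $x\in\mathbb{R}$, $$Zx=\begin{cases}x,&\text{if } f(x)\le 0;\\ x-\frac{1}{f'(x)}f(x),&\text{if } f(x)>0\text{ and }|f'(x)|\le\sqrt{2L\rho};\\ x-\frac{1}{f'(x)}\Big(f(x)+\Big(\frac{|f'(x)|}{\sqrt{2L}}-\sqrt{\rho}\Big)^2\Big),&\text{if } f(x)>0\text{ and }|f'(x)|>\sqrt{2L\rho}.\end{cases}$$ Set $D=\{x\in\mathbb{R}:\theta(x)\le 0\}$ and assume that the boundary of $D$ is contained in $\mathbb{R}\setminus C$. Then $D$ is a closed convex superset of $C$, and $Z$ is a subgradient projector of a function $y\colon\mathbb{R}\to\mathbb{R}$ defined as follows. On $D$, set $y=f$. The set $\mathbb{R}\setminus D$ is empty, or an open interval, or the disjoint union of two open intervals. For each of these nonempty open intervals $I$, let $q$ be a function on $I$ with $$q'(x)=\frac{1}{x-Zx}\quad\text{for all }x\in I,$$ let $d$ be the unique element of $P_D(I)$ (the endpoint of $I$ that belongs to $D$), which satisfies $d\in D\setminus C$, let $q(d)$ denote the limit of $q(x)$ as $x\to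 d$, $x\in I$, and set $$y(x)=\frac{f(d)}{e^{q(d)}}e^{q(x)}\quad\text{for all }x\in I.$$ The function $y\colon\mathbb{R}\to\mathbb{R}$ so constructed is convex, and it satisfies $Z=G_y$.
   Context: The Yamagishi–Yamada operator $Z$ of $f$ (with parameters $L,\rho$) is, in general for differentiable $f$, defined by $Zx=x$ if $f(x)\le 0$; $Zx=x-\frac{\nabla f(x)}{\|\nabla f(x)\|^2}f(x)$ if $f(x)>0$ and $\theta(x)\le 0$; $Zx=x-\frac{\nabla f(x)}{\|\nabla f(x)\|^2}\big(f(x)+(\sqrt{\theta(x)+\rho}-\sqrt{\rho})^2\big)$ if $f(x)>0$ and $\theta(x)>0$; here $\theta(x)=\frac{\|\nabla f(x)\|^2}{2L}-\rho$. $P_D$ denotes the projection onto $D$. For a convex continuous function $y\colon\mathbb{R}\to\mathbb{R}$ with $\{y\le0\}\neq\varnothing$ and a selection $s$ of its convex subdifferential $\partial y$, the associated subgradient projector is $G_y(x)=x-\frac{y(x)}{|s(x)|^2}s(x)$ if $y(x)>0$, and $G_y(x)=x$ otherwise (so $G_y(x)=x-y(x)/y'(x)$ at points where $y>0$ and $y$ is differentiable). *)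

theory Defs
  imports "HOL-Analysis.Analysis"
begin

text \<open>The gradient; it is a meaningful value only where \<open>f\<close> is Frechet differentiable with a
  Riesz representative of the derivative (on the real line: where \<open>f\<close> is differentiable).\<close>

definition grad :: "('a::real_inner \<Rightarrow> real) \<Rightarrow> 'a \<Rightarrow> 'a" where
  "grad f x = (THE v. GDERIV f x :> v)"

definition yy_theta :: "real \<Rightarrow> real \<Rightarrow> ('a::real_inner \<Rightarrow> real) \<Rightarrow> 'a \<Rightarrow> real" where
  "yy_theta L \<rho> f x = (norm (grad f x))\<^sup>2 / (2 * L) - \<rho>"

definition yamagishi_yamada :: "real \<Rightarrow> real \<Rightarrow> ('a::real_inner \<Rightarrow> real) \<Rightarrow> 'a \<Rightarrow> 'a" where
  "yamagishi_yamada L \<rho> f x =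
    (if f x \<le> 0 then x
     else if yy_theta L \<rho> f x \<le> 0
       then x - (f x / (norm (grad f x))\<^sup>2) *\<^sub>R grad f x
     else x - ((f x + (sqrt (yy_theta L \<rho> f x + \<rho>) - sqrt \<rho>)\<^sup>2) / (norm (grad f x))\<^sup>2) *\<^sub>R grad f x)"

definition subdifferential :: "(real \<Rightarrow> real) \<Rightarrow> real \<Rightarrow> real set" where
  "subdifferential y x = {u. \<forall>z. y x + u * (z - x) \<le> y z}"

definition subgradient_selection :: "(real \<Rightarrow> real) \<Rightarrow> (real \<Rightarrow> real) \<Rightarrow> bool" where
  "subgradient_selection y s \<longleftrightarrow> (\<forall>x. s x \<in> subdifferential y x)"

definition subgradient_projector :: "(real \<Rightarrow> real) \<Rightarrow> (real \<Rightarrow> real) \<Rightarrow> real \<Rightarrow> real" where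
  "subgradient_projector y s x = (if y x > 0 then x - y x / \<bar>s x\<bar>\<^sup>2 * s x else x)"

definition is_subgradient_projector_of :: "(real \<Rightarrow> real) \<Rightarrow> (real \<Rightarrow> real) \<Rightarrow> bool" where
  "is_subgradient_projector_of T y \<longleftrightarrow>
     convex_on UNIV y \<and> continuous_on UNIV y \<and> {x. y x \<le> 0} \<noteq> {} \<and>
     (\<exists>s. subgradient_selection y s \<and> T = subgradient_projector y s)"

definition open_interval :: "real set \<Rightarrow> bool" where
  "open_interval I \<longleftrightarrow> open I \<and> is_interval I \<and> I \<noteq> {}"

text \<open>Here \<open>closest_point D\<close> is the projection onto \<open>D\<close>. The functions \<open>q\<close> and the points
  \<open>d\<close> are indexed by the components \<open>I\<close> of the complement of \<open>D\<close>; the values of \<open>q I\<close> outside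
  \<open>I\<close> are irrelevant, and \<open>l I\<close> is the limit that extends \<open>q I\<close> to \<open>d I\<close>.\<close>

definition yy_construction ::
  "(real \<Rightarrow> real) \<Rightarrow> (real \<Rightarrow> real) \<Rightarrow> real set \<Rightarrow> (real set \<Rightarrow> real \<Rightarrow> real) \<Rightarrow>
    (real set \<Rightarrow> real) \<Rightarrow> (real set \<Rightarrow> real) \<Rightarrow> (real \<Rightarrow> real) \<Rightarrow> bool" where
  "yy_construction f Z D q d l y \<longleftrightarrow>
     (\<forall>x\<in>D. y x = f x) \<and>
     (\<forall>I\<in>components (- D).
        (\<forall>x\<in>I. (q I has_real_derivative 1 / (x - Z x)) (at x)) \<and>
        closest_point D ` I = {d I} \<and>
        (q I \<longlongrightarrow> l I) (at (d I) within I) \<and>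
        (\<forall>x\<in>I. y x = f (d I) / exp (l I) * exp (q I x)))"

end

theory Submission
  imports Defs
begin

text \<open>
  Write \<open>g = f'\<close> and \<open>Z x = x - h x\<close> where \<open>f x > 0\<close>. The descent lemma and \<open>f \<ge> - \<rho>\<close> give
  \<open>g\<^sup>2 / (2 L) \<le> f + \<rho>\<close>, so \<open>\<theta> \<le> f\<close> and \<open>C \<subseteq> D\<close>. On a component of \<open>- D\<close> the function \<open>y\<close> solves
  \<open>y' = y / h\<close>, whence \<open>y'' = y (1 - h') / h\<^sup>2\<close>, and the same inequality is exactly what yields
  \<open>h' \<le> 1\<close>. At the endpoint \<open>d\<close> we have \<open>y = f\<close> and \<open>h = f / g\<close>, so \<open>y'\<close> takes the value \<open>g d\<close> from
  both sides. Hence \<open>y\<close> is differentiable with nondecreasing derivative; its subgradients are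
  its derivatives, and \<open>y / y' = h\<close> wherever \<open>y > 0\<close>.
\<close>

section \<open>Real functions of one variable\<close>

text \<open>Precomposing with the projection onto \<open>K\<close> extends \<open>p\<close>
  continuously to the whole line. The antiderivative is therefore differentiable from both sides
  even at an endpoint of \<open>K\<close>, which is what the endpoint \<open>d\<close> of a
  component needs later.\<close>

lemma ex_antiderivative_closed_convex:
  fixes p :: "real \<Rightarrow> real"
  assumes "continuous_on K p" "closed K" "convex K" "K \<noteq> {}"
  obtains P where "\<And>x. x \<in> K \<Longrightarrow> (P has_real_derivative p x) (at x)"
proof -
  have "continuous_on UNIV (\<lambda>x. p (closest_point K x))"
    using assms continuous_on_closest_point[OF assms(3,2,4)]
    by (intro continuous_on_compose2[OF assms(1)]) (auto intro: closest_point_in_set)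
  then obtain P where P: "\<And>x. (P has_vector_derivative p (closest_point K x)) (at x)"
    using einterval_antiderivative[of "-\<infinity>" "\<infinity>" "\<lambda>x. p (closest_point K x)"]
    by (auto simp: continuous_on_eq_continuous_at)
  show thesis
  proof
    fix x assume "x \<in> K"
    then show "(P has_real_derivative p x) (at x)"
      using P[of x] by (simp add: closest_point_self has_real_derivative_iff_has_vector_derivative)
  qed
qed

lemma antiderivatives_differ_by_constant:
  fixes P q :: "real \<Rightarrow> real"
  assumes "convex I"
    and "\<And>x. x \<in> I \<Longrightarrow> (P has_real_derivative p x) (at x)"
    and "\<And>x. x \<in> I \<Longrightarrow> (q has_real_derivative p x) (at x)"
  obtains c where "\<And>x. x \<in> I \<Longrightarrow> q x = P x + c"
proof -
  have "\<exists>c. \<forall>x\<in>I. q x - P x = c"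
  proof (rule has_field_derivative_zero_constant[OF assms(1)])
    fix x assume "x \<in> I"
    show "((\<lambda>x. q x - P x) has_real_derivative 0) (at x within I)"
      using DERIV_diff[OF assms(3,2)[OF \<open>x \<in> I\<close>]] by (simp add: has_field_derivative_at_within)
  qed
  then show thesis using that by (metis add.commute diff_eq_eq)
qed

lemma has_field_derivative_within_Un:
  "(f has_field_derivative f') (at x within S \<union> T) \<longleftrightarrow>
    (f has_field_derivative f') (at x within S) \<and> (f has_field_derivative f') (at x within T)"
  by (simp add: has_field_derivative_iff Lim_within_Un)

text \<open>The filter at such a point is trivial, so every \<open>f'\<close> qualifies. This
  disposes of the pieces away from \<open>x\<close> when derivatives are glued.\<close>

lemma has_field_derivative_within_not_in_closure:
  "x \<notin> closure S \<Longrightarrow> (f has_field_derivative f') (at x within S)"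
  using not_in_closure_trivial_limitI[of x S] by (simp add: has_field_derivative_iff)

lemma has_field_derivative_transform_on:
  assumes "(h has_field_derivative f') (at x)" "x \<in> S" "\<And>z. z \<in> S \<Longrightarrow> f z = h z"
  shows "(f has_field_derivative f') (at x within S)"
  using has_field_derivative_transform_within[OF has_field_derivative_at_within[OF assms(1), of S]
      zero_less_one assms(2)] assms(3) by simp

text \<open>A subgradient \<open>u\<close> makes \<open>y z - u * z\<close> minimal at
  \<open>x\<close>, so Fermat's rule applies. Hence a differentiable function admits at most one
  subgradient selection.\<close>

lemma subdifferential_eq_derivative:
  assumes "(y has_real_derivative y') (at x)" "u \<in> subdifferential y x"
  shows "u = y'"
proof -
  have "((\<lambda>z. y z - u * z) has_real_derivative (y' - u)) (at x)"
    by (auto intro!: derivative_eq_intros assms(1))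
  moreover have "\<forall>z. \<bar>x - z\<bar> < 1 \<longrightarrow> y x - u * x \<le> y z - u * z"
    using assms(2) by (auto simp: subdifferential_def algebra_simps)
  ultimately show ?thesis using DERIV_local_min[OF _ zero_less_one, of "\<lambda>z. y z - u * z" "y' - u" x] by simp
qed

section \<open>Complements of closed intervals\<close>

text \<open>\<open>A\<close> collects the points below all of \<open>D\<close> and \<open>B\<close>
  those above all of \<open>D\<close>. Convexity excludes any other point of the complement, and
  closedness puts a finite \<open>Inf D\<close> or \<open>Sup D\<close> into
  \<open>D\<close>.\<close>

lemma components_Compl_closed_convex_real:
  fixes D :: "real set"
  assumes "closed D" "convex D" "D \<noteq> {}"
  obtains A B where "A = {} \<or> (\<exists>d\<in>D. A = {..<d} \<and> D \<subseteq> {d..})"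
    "B = {} \<or> (\<exists>d\<in>D. B = {d<..} \<and> D \<subseteq> {..d})"
    "- D = A \<union> B" "A \<inter> B = {}" "components (- D) = {A, B} - {{}}"
proof
  define A where "A = {x. \<forall>z\<in>D. x < z}"
  define B where "B = {x. \<forall>z\<in>D. z < x}"
  show A: "A = {} \<or> (\<exists>d\<in>D. A = {..<d} \<and> D \<subseteq> {d..})"
  proof (cases "A = {}")
    case False
    then have bdd: "bdd_below D" by (auto simp: A_def bdd_below_def intro: less_imp_le)
    then have "Inf D \<in> D" using closed_contains_Inf assms by blast
    moreover from this have "A = {..<Inf D}"
      using bdd by (auto simp: A_def intro: cInf_lower less_le_trans)
    ultimately show ?thesis using bdd by (auto intro!: cInf_lower bexI[of _ "Inf D"])
  qed simp
  show B: "B = {} \<or> (\<exists>d\<in>D. B = {d<..} \<and> D \<subseteq> {..d})"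
  proof (cases "B = {}")
    case False
    then have bdd: "bdd_above D" by (auto simp: B_def bdd_above_def intro: less_imp_le)
    then have "Sup D \<in> D" using closed_contains_Sup assms by blast
    moreover from this have "B = {Sup D<..}"
      using bdd by (auto simp: B_def intro: cSup_upper le_less_trans)
    ultimately show ?thesis using bdd by (auto intro!: cSup_upper bexI[of _ "Sup D"])
  qed simp
  show un: "- D = A \<union> B"
  proof (intro equalityI subsetI)
    fix x assume x: "x \<in> - D"
    show "x \<in> A \<union> B"
    proof (rule ccontr)
      assume "x \<notin> A \<union> B"
      then obtain u v where "u \<in> D" "v \<in> D" "u \<le> x" "x \<le> v"
        by (auto simp: A_def B_def not_less)
      then show False
        using x mem_is_interval_1_I[of D u v x] assms(2) by (auto simp: is_interval_convex_1)
    qed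
  qed (auto simp: A_def B_def)
  show disj: "A \<inter> B = {}" using assms(3) by (force simp: A_def B_def)
  show "components (- D) = {A, B} - {{}}"
  proof (rule components_open_unique)
    show "pairwise disjnt ({A, B} - {{}})"
      using disj by (auto simp: pairwise_def disjnt_def)
    show "\<Union> ({A, B} - {{}}) = - D" using un by auto
    show "open X \<and> connected X \<and> X \<noteq> {}" if "X \<in> {A, B} - {{}}" for X
      using that A B by auto
  qed
qed

text \<open>One statement for components on either side of \<open>D\<close>. The last clause records
  the side and is used only to compare \<open>d\<close> with other points; the analysis on
  \<open>I\<close> is the same for both.\<close>

lemma component_Compl_closed_convex_real:
  fixes D :: "real set"
  assumes "closed D" "convex D" "D \<noteq> {}" "I \<in> components (- D)"
  obtains d where "d \<in> D" "open I" "convex I" "I \<noteq> {}" "d \<notin> I" "closure I = insert d I"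
    "convex (insert d I)" "frontier I = {d}" "closest_point D ` I = {d}"
    "(\<forall>x\<in>I. \<forall>z\<in>D. x < d \<and> d \<le> z) \<or> (\<forall>x\<in>I. \<forall>z\<in>D. z \<le> d \<and> d < x)"
proof -
  obtain A B where AB: "A = {} \<or> (\<exists>d\<in>D. A = {..<d} \<and> D \<subseteq> {d..})"
    "B = {} \<or> (\<exists>d\<in>D. B = {d<..} \<and> D \<subseteq> {..d})" "components (- D) = {A, B} - {{}}"
    using components_Compl_closed_convex_real[OF assms(1-3)] by metis
  then have "(\<exists>d\<in>D. I = {..<d} \<and> D \<subseteq> {d..}) \<or> (\<exists>d\<in>D. I = {d<..} \<and> D \<subseteq> {..d})"
    using assms(4) by auto
  then consider d where "d \<in> D" "I = {..<d}" "D \<subseteq> {d..}"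
    | d where "d \<in> D" "I = {d<..}" "D \<subseteq> {..d}" by auto
  then show thesis
  proof cases
    case 1
    have cp: "closest_point D x = d" if "x < d" for x
      using closest_point_unique[OF assms(2,1) 1(1), of x] 1(3) that by (force simp: dist_real_def)
    have "insert d I = {..d}" using 1(2) by auto
    moreover have "closest_point D ` I = {d}" using cp 1(2) lt_ex[of d] by force
    ultimately show thesis using 1 that[of d] by auto
  next
    case 2
    have cp: "closest_point D x = d" if "d < x" for x
      using closest_point_unique[OF assms(2,1) 2(1), of x] 2(3) that by (force simp: dist_real_def)
    have "insert d I = {d..}" using 2(2) by auto
    moreover have "closest_point D ` I = {d}" using cp 2(2) gt_ex[of d] by force
    ultimately show thesis using 2 that[of d] by auto
  qed
qed

section \<open>The step length\<close>

text \<open>\<open>g\<close> and \<open>g'\<close> stand for the first and second derivatives of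
  \<open>f\<close>; the latter is only a pointwise derivative of \<open>g\<close>.\<close>

locale bounded_below_convex =
  fixes f g g' :: "real \<Rightarrow> real" and L \<rho> :: real
  assumes convex_f: "convex_on UNIV f"
    and f_deriv: "(f has_real_derivative g x) (at x)"
    and g_deriv: "(g has_real_derivative g' x) (at x)"
    and L_pos: "L > 0" and \<rho>_pos: "\<rho> > 0"
    and lipschitz_g: "L-lipschitz_on UNIV g"
    and f_lower: "- \<rho> \<le> f x"
    and ex_nonpos: "\<exists>x. f x \<le> 0"
begin

text \<open>Since \<open>sqrt (theta + rho)\<close> equals
  \<open>\<bar>g x\<bar> / sqrt (2 * L)\<close>, truncation at 0 merges the two nontrivial cases of
  the operator into one formula.\<close>

definition excess :: "real \<Rightarrow> real" where
  "excess x = max 0 (\<bar>g x\<bar> / sqrt (2 * L) - sqrt \<rho>)"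

text \<open>The signed displacement \<open>x - Z x\<close> where \<open>f x > 0\<close>, that is,
  the function \<open>h\<close> of the overview.\<close>

definition step :: "real \<Rightarrow> real" where
  "step x = (f x + (excess x)\<^sup>2) / g x"

lemma f_cont: "continuous_on S f"
  using f_deriv DERIV_isCont continuous_at_imp_continuous_on by blast

lemma g_cont: "continuous_on S g"
  using g_deriv DERIV_isCont continuous_at_imp_continuous_on by blast

lemma above_tangent: "f x + g x * (z - x) \<le> f z"
  using convex_on_imp_above_tangent[OF convex_f connected_UNIV, of x z "g x"] f_deriv[of x] by simp

lemma g_mono: "x \<le> z \<Longrightarrow> g x \<le> g z"
proof -
  assume "x \<le> z"
  have "0 \<le> (g z - g x) * (z - x)"
    using above_tangent[of x z] above_tangent[of z x] by (simp add: algebra_simps)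
  then show ?thesis using \<open>x \<le> z\<close> by (cases "x = z") (auto simp: zero_le_mult_iff)
qed

lemma g'_nonneg: "0 \<le> g' x"
proof -
  have "mono_on UNIV g" using g_mono by (simp add: mono_onI)
  then show ?thesis using mono_on_imp_deriv_nonneg[OF _ g_deriv[of x], of UNIV] by simp
qed

text \<open>A horizontal tangent would make \<open>f x > 0\<close> a global minimum, contradicting
  \<open>ex_nonpos\<close>.\<close>

lemma g_nonzero: "f x > 0 \<Longrightarrow> g x \<noteq> 0"
  using above_tangent[of x] ex_nonpos by (metis add.right_neutral mult_zero_left not_less order.trans)

lemma descent: "f z \<le> f x + g x * (z - x) + L / 2 * (z - x)\<^sup>2"
proof -
  \<comment> \<open>The quadratic majorant minus \<open>f\<close>. By the Lipschitz bound it is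
    nonincreasing to the left of \<open>x\<close> and nondecreasing to the right, and it vanishes at
    \<open>x\<close>.\<close>
  define \<psi> where "\<psi> t = f x + g x * (t - x) + L / 2 * (t - x)\<^sup>2 - f t" for t
  have d: "(\<psi> has_real_derivative (L * (t - x) - (g t - g x))) (at t)" for t
    unfolding \<psi>_def by (auto intro!: derivative_eq_intros f_deriv)
  have lip: "\<bar>g t - g x\<bar> \<le> L * \<bar>t - x\<bar>" for t
    using lipschitz_onD[OF lipschitz_g, of t x] by (simp add: dist_real_def)
  have "\<psi> x \<le> \<psi> z"
  proof (cases "x \<le> z")
    case True
    show ?thesis
    proof (rule DERIV_nonneg_imp_nondecreasing[OF True])
      fix t assume "x \<le> t" "t \<le> z"
      then show "\<exists>y. DERIV \<psi> t :> y \<and> 0 \<le> y" using d[of t] lip[of t] by fastforce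
    qed
  next
    case False
    then have "z \<le> x" by simp
    then show ?thesis
    proof (rule DERIV_nonpos_imp_nonincreasing)
      fix t assume t: "z \<le> t" "t \<le> x"
      then have "L * (t - x) - (g t - g x) \<le> 0" using lip[of t] by (simp add: algebra_simps)
      then show "\<exists>y. DERIV \<psi> t :> y \<and> y \<le> 0" using d[of t] by blast
    qed
  qed
  then show ?thesis by (simp add: \<psi>_def)
qed

lemma slope_bound: "(g x)\<^sup>2 \<le> 2 * L * (f x + \<rho>)"
proof -
  \<comment> \<open>The point \<open>x - g x / L\<close> minimizes the quadratic majorant of
    \<open>descent\<close>, so it gives the sharpest comparison with the lower bound.\<close>
  have "- \<rho> \<le> f (x - g x / L)" by (rule f_lower)
  also have "\<dots> \<le> f x - (g x)\<^sup>2 / (2 * L)"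
    using descent[of "x - g x / L" x] L_pos by (simp add: power2_eq_square diff_divide_distrib)
  finally show ?thesis using L_pos by (simp add: field_simps)
qed

lemma excess_eq_0_iff: "excess x = 0 \<longleftrightarrow> \<bar>g x\<bar> \<le> sqrt (2 * L * \<rho>)"
  using L_pos by (auto simp: excess_def real_sqrt_mult divide_simps max_def mult_ac)

text \<open>The left-hand side is the condition \<open>theta <= 0\<close> that defines
  \<open>D\<close>.\<close>

lemma slope_le_iff: "\<bar>g x\<bar>\<^sup>2 / (2 * L) - \<rho> \<le> 0 \<longleftrightarrow> excess x = 0"
  using L_pos \<rho>_pos by (simp add: excess_eq_0_iff real_le_rsqrt sqrt_le_D field_simps
      flip: real_sqrt_le_iff[of "(g x)\<^sup>2"])

lemma excess_cont: "continuous_on S excess"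
  unfolding excess_def by (intro continuous_intros g_cont) (use L_pos in auto)

lemma step_cont: "(\<And>x. x \<in> S \<Longrightarrow> f x > 0) \<Longrightarrow> continuous_on S step"
  unfolding step_def by (intro continuous_intros f_cont g_cont excess_cont) (use g_nonzero in auto)

lemma step_nonzero: "f x > 0 \<Longrightarrow> step x \<noteq> 0"
  using g_nonzero[of x] add_pos_nonneg[OF _ zero_le_power2[of "excess x"]]
  by (fastforce simp: step_def)

lemma f_pos_of_excess: "excess x \<noteq> 0 \<Longrightarrow> f x > 0"
proof -
  assume "excess x \<noteq> 0"
  then have "\<rho> < (g x)\<^sup>2 / (2 * L)" using slope_le_iff[of x] by simp
  also have "\<dots> \<le> f x + \<rho>" using slope_bound[of x] L_pos by (simp add: field_simps)
  finally show ?thesis by simp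
qed

text \<open>On an interval where the excess is positive and \<open>g\<close> has constant sign, expanding the square
  makes the only nondifferentiable term \<open>\<bar>g\<bar> / g\<close> constant.\<close>

lemma step_deriv:
  assumes "open I" "x \<in> I" "\<And>z. z \<in> I \<Longrightarrow> excess z > 0" "\<And>z. z \<in> I \<Longrightarrow> sgn (g z) = s"
  obtains r where "(step has_real_derivative r) (at x)" "r \<le> 1"
proof
  \<comment> \<open>The numerator of \<open>step\<close> after expansion, without the cross term;
    divided by \<open>g z\<close>, the cross term is the constant subtracted below.\<close>
  define N where "N z = f z + (g z)\<^sup>2 / (2 * L) + \<rho>" for z
  let ?r = "((g x + g x * g' x / L) * g x - N x * g' x) / (g x * g x)"
  have nz: "g z \<noteq> 0" if "z \<in> I" for z
    using assms(3)[OF that] f_pos_of_excess[of z] g_nonzero[of z] by simp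
  have "((\<lambda>z. N z / g z - 2 * sqrt \<rho> / sqrt (2 * L) * s) has_real_derivative ?r) (at x)"
    unfolding N_def using nz[OF assms(2)] L_pos
    by (auto intro!: derivative_eq_intros f_deriv g_deriv simp: field_simps)
  moreover have "N z / g z - 2 * sqrt \<rho> / sqrt (2 * L) * s = step z" if "z \<in> I" for z
  proof -
    have "(excess z)\<^sup>2 = (\<bar>g z\<bar> / sqrt (2 * L) - sqrt \<rho>)\<^sup>2"
      using assms(3)[OF that] by (auto simp: excess_def max_def split: if_splits)
    also have "\<dots> = (g z)\<^sup>2 / (2 * L) + \<rho> - 2 * sqrt \<rho> / sqrt (2 * L) * \<bar>g z\<bar>"
      using L_pos \<rho>_pos by (simp add: power2_diff power_divide)
    also have "\<bar>g z\<bar> = s * g z"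
      using assms(4)[OF that] by (metis abs_sgn mult.commute)
    finally have "(excess z)\<^sup>2 = (g z)\<^sup>2 / (2 * L) + \<rho> - 2 * sqrt \<rho> / sqrt (2 * L) * s * g z"
      by simp
    then show ?thesis using nz[OF that] by (simp add: step_def N_def diff_divide_distrib add_divide_distrib)
  qed
  ultimately show "(step has_real_derivative ?r) (at x)"
    using has_field_derivative_transform_within_open[OF _ assms(1,2)] by blast
  \<comment> \<open>\<open>slope_bound\<close> supplies a second copy of
    \<open>(g x)\<^sup>2 / (2 * L)\<close> below \<open>f x + \<rho>\<close>. After multiplication
    by \<open>g' x >= 0\<close> this is precisely the inequality that bounds the quotient by
    1.\<close>
  have "(g x)\<^sup>2 / L \<le> N x" using slope_bound[of x] L_pos by (simp add: N_def field_simps)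
  then have "(g x)\<^sup>2 / L * g' x \<le> N x * g' x" using g'_nonneg by (rule mult_right_mono)
  then have "(g x + g x * g' x / L) * g x - N x * g' x \<le> g x * g x"
    by (simp add: power2_eq_square algebra_simps)
  moreover have "0 < g x * g x" using nz[OF assms(2)] by (metis not_real_square_gt_zero)
  ultimately show "?r \<le> 1" by (metis divide_le_eq_1_pos)
qed

end

section \<open>Extending the function across one component\<close>

text \<open>A component of the complement of \<open>D\<close> together with its endpoint
  \<open>d\<close>, without reference to the side of \<open>D\<close> on which it lies.\<close>

locale steep_interval = bounded_below_convex +
  fixes I :: "real set" and d :: real
  assumes open_I: "open I" and convex_I: "convex I" and d_notin: "d \<notin> I"
    and closure_I: "closure I = insert d I" and convex_insert: "convex (insert d I)"
    and excess_pos: "\<And>x. x \<in> I \<Longrightarrow> excess x > 0"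
    and excess_d: "excess d = 0" and f_d: "f d > 0"
begin

lemma f_pos: "x \<in> insert d I \<Longrightarrow> f x > 0"
  using f_d f_pos_of_excess excess_pos by fastforce

text \<open>The image of an interval under the continuous \<open>g\<close> is an interval, and this
  one avoids 0.\<close>

lemma sgn_g_const: "x \<in> insert d I \<Longrightarrow> sgn (g x) = sgn (g d)"
proof -
  assume x: "x \<in> insert d I"
  have "is_interval (g ` insert d I)"
    using convex_connected[OF convex_insert] connected_continuous_image[OF g_cont]
    by (simp only: is_interval_connected_1)
  moreover have "0 \<notin> g ` insert d I" using g_nonzero f_pos by force
  ultimately have "\<not> (g u < 0 \<and> 0 < g v)" if "u \<in> insert d I" "v \<in> insert d I" for u v
    using that mem_is_interval_1_I[of "g ` insert d I" "g u" "g v" 0] by (meson imageI less_imp_le)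
  then show ?thesis using x g_nonzero[OF f_pos[OF x]] g_nonzero[OF f_d] by (force simp: sgn_real_def)
qed

lemma ex_primitive:
  obtains P where "\<And>x. x \<in> insert d I \<Longrightarrow> (P has_real_derivative 1 / step x) (at x)"
proof (rule ex_antiderivative_closed_convex)
  show "continuous_on (insert d I) (\<lambda>x. 1 / step x)"
    by (intro continuous_intros step_cont) (use f_pos step_nonzero in auto)
  show "closed (insert d I)" using closure_I by (metis closed_closure)
qed (use convex_insert that in auto)

lemma at_d_nontrivial: "at d within I \<noteq> bot"
  using closure_I d_notin by (simp add: at_within_eq_bot_iff)

text \<open>Any admissible \<open>q\<close> differs on \<open>I\<close> by a constant from a
  primitive \<open>P\<close> that is continuous at \<open>d\<close>; hence the limit at
  \<open>d\<close> exists.\<close>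

lemma primitive_tendsto:
  assumes "\<And>x. x \<in> I \<Longrightarrow> (q has_real_derivative 1 / step x) (at x)"
  obtains P c where "\<And>x. x \<in> insert d I \<Longrightarrow> (P has_real_derivative 1 / step x) (at x)"
    "\<And>x. x \<in> I \<Longrightarrow> q x = P x + c" "(q \<longlongrightarrow> P d + c) (at d within I)"
proof -
  obtain P where P: "\<And>x. x \<in> insert d I \<Longrightarrow> (P has_real_derivative 1 / step x) (at x)"
    using ex_primitive by blast
  obtain c where c: "\<And>x. x \<in> I \<Longrightarrow> q x = P x + c"
    using antiderivatives_differ_by_constant[OF convex_I, of P "\<lambda>x. 1 / step x" q] P assms by blast
  have "(P \<longlongrightarrow> P d) (at d within I)"
    using DERIV_isCont[OF P[of d]] continuous_at_imp_continuous_at_within continuous_within by blast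
  then have "((\<lambda>x. P x + c) \<longlongrightarrow> P d + c) (at d within I)" by (intro tendsto_intros)
  then have "(q \<longlongrightarrow> P d + c) (at d within I)"
    by (rule Lim_transform_eventually) (simp add: c eventually_at_filter)
  then show thesis using that P c by blast
qed

context
  fixes q y :: "real \<Rightarrow> real" and l :: real
  assumes q_deriv: "\<And>x. x \<in> I \<Longrightarrow> (q has_real_derivative 1 / step x) (at x)"
    and q_lim: "(q \<longlongrightarrow> l) (at d within I)"
    and y_I: "\<And>x. x \<in> I \<Longrightarrow> y x = f d / exp l * exp (q x)"
    and y_d: "y d = f d"
begin

text \<open>The limit forces \<open>l = P d + c\<close>, so the arbitrary constant \<open>c\<close>
  cancels and \<open>y\<close> becomes \<open>f d * exp (P x - P d)\<close>. Unlike
  \<open>y\<close>, this \<open>Y\<close> is known to be differentiable from both sides at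
  \<open>d\<close>.\<close>

lemma extension:
  obtains Y where "\<And>x. x \<in> insert d I \<Longrightarrow> y x = Y x" "\<And>x. Y x > 0"
    "\<And>x. x \<in> insert d I \<Longrightarrow> (Y has_real_derivative Y x / step x) (at x)"
proof -
  obtain P c where P: "\<And>x. x \<in> insert d I \<Longrightarrow> (P has_real_derivative 1 / step x) (at x)"
    and c: "\<And>x. x \<in> I \<Longrightarrow> q x = P x + c" and lim: "(q \<longlongrightarrow> P d + c) (at d within I)"
    using primitive_tendsto[OF q_deriv] by blast
  have l: "l = P d + c" using tendsto_unique[OF at_d_nontrivial q_lim lim] .
  show thesis
  proof
    fix x assume "x \<in> insert d I"
    then show "y x = f d * exp (P x - P d)"
      using y_I y_d c l by (auto simp: exp_diff exp_add)
    show "((\<lambda>x. f d * exp (P x - P d)) has_real_derivative f d * exp (P x - P d) / step x) (at x)"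
      by (auto intro!: derivative_eq_intros P \<open>x \<in> insert d I\<close>)
  qed (use f_d in simp)
qed

lemma extension_pos: "x \<in> insert d I \<Longrightarrow> y x > 0"
  using extension by metis

lemma extension_deriv: "x \<in> insert d I \<Longrightarrow> (y has_real_derivative y x / step x) (at x within insert d I)"
proof -
  assume x: "x \<in> insert d I"
  obtain Y where Y: "\<And>x. x \<in> insert d I \<Longrightarrow> y x = Y x"
    "\<And>x. x \<in> insert d I \<Longrightarrow> (Y has_real_derivative Y x / step x) (at x)"
    using extension by metis
  show ?thesis using has_field_derivative_transform_on[OF Y(2)[OF x] x, of y] Y(1) x by simp
qed

text \<open>The quotient is differentiated only at interior points, where \<open>step_deriv\<close>
  applies; continuity carries monotonicity up to \<open>d\<close>.\<close>

lemma extension_slope_mono: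
  assumes "x \<in> insert d I" "z \<in> insert d I" "x \<le> z"
  shows "y x / step x \<le> y z / step z"
proof -
  obtain Y where Y: "\<And>x. x \<in> insert d I \<Longrightarrow> y x = Y x" "\<And>x. Y x > 0"
    "\<And>x. x \<in> insert d I \<Longrightarrow> (Y has_real_derivative Y x / step x) (at x)"
    using extension by metis
  have sub: "t \<in> insert d I" if "x \<le> t" "t \<le> z" for t
    using mem_is_interval_1_I[of "insert d I" x z t] convex_insert assms that
    by (simp add: is_interval_convex_1)
  \<comment> \<open>An interior point cannot be \<open>d\<close>: both ends would then lie in the
    convex set \<open>I\<close>, and so would \<open>d\<close>.\<close>
  have sub_open: "t \<in> I" if "x < t" "t < z" for t
  proof (rule ccontr)
    assume "t \<notin> I"
    then have "t = d" using sub[of t] that by simp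
    then have "x \<in> I" "z \<in> I" using assms that by auto
    then show False
      using mem_is_interval_1_I[of I x z t] convex_I that \<open>t \<notin> I\<close> by (simp add: is_interval_convex_1)
  qed
  have "Y x / step x \<le> Y z / step z"
  proof (rule DERIV_nonneg_imp_increasing_open[OF assms(3)])
    fix t assume t: "x < t" "t < z"
    have tI: "t \<in> I" using sub_open t by blast
    obtain r where r: "(step has_real_derivative r) (at t)" "r \<le> 1"
      using step_deriv[OF open_I tI excess_pos] sgn_g_const by blast
    have nz: "step t \<noteq> 0" using step_nonzero f_pos tI by blast
    have "((\<lambda>t. Y t / step t) has_real_derivative
        (Y t / step t * step t - Y t * r) / (step t * step t)) (at t)"
      using DERIV_divide[OF Y(3) r(1) nz] tI by simp
    \<comment> \<open>The numerator is \<open>Y t * (1 - r)\<close>.\<close>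
    moreover have "0 \<le> (Y t / step t * step t - Y t * r) / (step t * step t)"
      using nz r(2) Y(2)[of t] by simp
    ultimately show "\<exists>y. DERIV (\<lambda>x. Y x / step x) t :> y \<and> 0 \<le> y" by blast
  next
    have "continuous_on {x..z} Y" using DERIV_isCont[OF Y(3)[OF sub]]
      by (intro continuous_at_imp_continuous_on) auto
    then show "continuous_on {x..z} (\<lambda>x. Y x / step x)"
      using sub f_pos step_nonzero by (intro continuous_intros step_cont) auto
  qed
  then show ?thesis using Y(1) assms by simp
qed

end

end


section \<open>Gluing\<close>

context bounded_below_convex
begin

text \<open>The set \<open>D\<close> of the theorem, expressed through the excess.\<close>

definition shallow :: "real set" where
  "shallow = {x. excess x = 0}"

lemma closed_shallow: "closed shallow"
  using closed_Collect_eq[of excess "\<lambda>_. 0"] excess_cont by (simp add: shallow_def)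

text \<open>Monotonicity of \<open>g\<close> makes every set of the form
  \<open>\<bar>g x\<bar> <= c\<close> an interval.\<close>

lemma convex_shallow: "convex shallow"
proof -
  have "\<bar>g t\<bar> \<le> c" if "\<bar>g x\<bar> \<le> c" "\<bar>g z\<bar> \<le> c" "x \<le> t" "t \<le> z" for x z t c
    using g_mono[OF that(3)] g_mono[OF that(4)] that by linarith
  then have "is_interval shallow" unfolding is_interval_1 shallow_def excess_eq_0_iff by blast
  then show ?thesis by (simp add: is_interval_convex_1)
qed

lemma nonpos_subset_shallow: "{x. f x \<le> 0} \<subseteq> shallow"
  using f_pos_of_excess by (force simp: shallow_def)

lemma shallow_nonempty: "shallow \<noteq> {}"
  using nonpos_subset_shallow ex_nonpos by blast

lemma steep_component:
  assumes "frontier shallow \<subseteq> {x. f x > 0}" "I \<in> components (- shallow)"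
  obtains d where "d \<in> shallow" "f d > 0" "frontier I = {d}" "closest_point shallow ` I = {d}"
    "steep_interval f g g' L \<rho> I d"
    "(\<forall>x\<in>I. \<forall>z\<in>shallow. x < d \<and> d \<le> z) \<or> (\<forall>x\<in>I. \<forall>z\<in>shallow. z \<le> d \<and> d < x)"
proof -
  obtain d where d: "d \<in> shallow" "open I" "convex I" "I \<noteq> {}" "d \<notin> I" "closure I = insert d I"
    "convex (insert d I)" "frontier I = {d}" "closest_point shallow ` I = {d}"
    "(\<forall>x\<in>I. \<forall>z\<in>shallow. x < d \<and> d \<le> z) \<or> (\<forall>x\<in>I. \<forall>z\<in>shallow. z \<le> d \<and> d < x)"
    using component_Compl_closed_convex_real[OF closed_shallow convex_shallow shallow_nonempty
        assms(2)] by metis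
  have sub: "I \<subseteq> - shallow" using assms(2) by (rule in_components_subset)
  \<comment> \<open>\<open>d\<close> lies in \<open>shallow\<close> and in the closure of
    \<open>I\<close>, hence in the closure of the complement; this is where the boundary hypothesis
    yields \<open>f d > 0\<close>.\<close>
  then have "d \<in> frontier shallow"
    using d(1,6) closure_mono[OF sub] closure_subset[of shallow] by (auto simp: frontier_closures)
  then have "f d > 0" using assms(1) by blast
  moreover have "excess x > 0" if "x \<in> I" for x
    using that sub by (fastforce simp: shallow_def excess_def)
  ultimately have "steep_interval f g g' L \<rho> I d"
    using d by unfold_locales (auto simp: shallow_def)
  then show thesis using that d \<open>f d > 0\<close> by blast
qed

context
  fixes y :: "real \<Rightarrow> real"
  assumes frontier_pos: "frontier shallow \<subseteq> {x. f x > 0}"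
    and y_shallow: "\<And>x. x \<in> shallow \<Longrightarrow> y x = f x"
    and y_steep: "\<And>I d. I \<in> components (- shallow) \<Longrightarrow> closest_point shallow ` I = {d} \<Longrightarrow>
      \<exists>q l. (\<forall>x\<in>I. (q has_real_derivative 1 / step x) (at x)) \<and> (q \<longlongrightarrow> l) (at d within I) \<and>
        (\<forall>x\<in>I. y x = f d / exp l * exp (q x))"
begin

text \<open>The candidate for the derivative of \<open>y\<close>. Endpoints of components belong to
  \<open>shallow\<close> and so fall under the first branch.\<close>

definition slope :: "real \<Rightarrow> real" where
  "slope x = (if x \<in> shallow then g x else y x / step x)"

lemma glued_component:
  assumes "I \<in> components (- shallow)"
  obtains d where "d \<in> shallow" "closure I = insert d I"
    "(\<forall>x\<in>I. \<forall>z\<in>shallow. x < d \<and> d \<le> z) \<or> (\<forall>x\<in>I. \<forall>z\<in>shallow. z \<le> d \<and> d < x)"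
    "\<And>x. x \<in> I \<Longrightarrow> y x > 0"
    "\<And>x. x \<in> insert d I \<Longrightarrow> (y has_real_derivative slope x) (at x within insert d I)"
    "\<And>x z. x \<in> insert d I \<Longrightarrow> z \<in> insert d I \<Longrightarrow> x \<le> z \<Longrightarrow> slope x \<le> slope z"
proof -
  obtain d where d: "d \<in> shallow" "closest_point shallow ` I = {d}"
    "steep_interval f g g' L \<rho> I d"
    "(\<forall>x\<in>I. \<forall>z\<in>shallow. x < d \<and> d \<le> z) \<or> (\<forall>x\<in>I. \<forall>z\<in>shallow. z \<le> d \<and> d < x)"
    using steep_component[OF frontier_pos assms] by metis
  interpret S: steep_interval f g g' L \<rho> I d by fact
  obtain q l where q: "\<And>x. x \<in> I \<Longrightarrow> (q has_real_derivative 1 / step x) (at x)"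
    "(q \<longlongrightarrow> l) (at d within I)" "\<And>x. x \<in> I \<Longrightarrow> y x = f d / exp l * exp (q x)"
    using y_steep[OF assms d(2)] by blast
  note ext = q y_shallow[OF d(1)]
  \<comment> \<open>Zero excess reduces \<open>step d\<close> to \<open>f d / g d\<close>, so both
    branches of \<open>slope\<close> give \<open>g d\<close> at the endpoint.\<close>
  have "slope d = y d / step d"
    using d(1) S.f_d g_nonzero[OF S.f_d] y_shallow[OF d(1)]
    by (simp add: slope_def step_def S.excess_d)
  then have sl: "slope x = y x / step x" if "x \<in> insert d I" for x
    using that in_components_subset[OF assms] by (auto simp: slope_def)
  show thesis
  proof (rule that[OF d(1) S.closure_I d(4)])
    show "y x > 0" if "x \<in> I" for x using S.extension_pos[OF ext] that by blast
    show "(y has_real_derivative slope x) (at x within insert d I)" if "x \<in> insert d I" for x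
      using S.extension_deriv[OF ext that] sl[OF that] by simp
    show "slope x \<le> slope z" if "x \<in> insert d I" "z \<in> insert d I" "x \<le> z" for x z
      using S.extension_slope_mono[OF ext that] sl that by simp
  qed
qed

lemma component_of_steep:
  assumes "x \<notin> shallow"
  obtains I where "I \<in> components (- shallow)" "x \<in> I"
  using assms Union_components[of "- shallow"] that by blast

lemma glued_pos: "x \<notin> shallow \<Longrightarrow> y x > 0"
  by (metis component_of_steep glued_component)

text \<open>The line is the union of the closed sets \<open>shallow\<close>,
  \<open>closure A\<close> and \<open>closure B\<close>. On each of them the derivative within the
  set is \<open>slope x\<close>, trivially so if \<open>x\<close> lies outside, and these combine to
  a two-sided derivative.\<close>

lemma glued_deriv: "(y has_real_derivative slope x) (at x)"
proof -
  obtain A B where AB: "- shallow = A \<union> B" "components (- shallow) = {A, B} - {{}}"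
    using components_Compl_closed_convex_real[OF closed_shallow convex_shallow shallow_nonempty]
    by metis
  have closure: "(y has_real_derivative slope x) (at x within closure I)" if "I \<in> {A, B}" for I
  proof (cases "I = {} \<or> x \<notin> closure I")
    case True
    then show ?thesis using has_field_derivative_within_not_in_closure[of x "closure I"] by auto
  next
    case False
    then show ?thesis using that AB(2) glued_component[of I] by (metis Diff_iff singletonD)
  qed
  have "(y has_real_derivative slope x) (at x within shallow)"
  proof (cases "x \<in> shallow")
    case True
    then show ?thesis
      using has_field_derivative_transform_on[OF f_deriv True, of y] y_shallow by (simp add: slope_def)
  next
    case False
    then show ?thesis
      using closed_shallow by (intro has_field_derivative_within_not_in_closure) simp
  qed
  then have "(y has_real_derivative slope x) (at x within shallow \<union> (closure A \<union> closure B))"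
    using closure by (simp add: has_field_derivative_within_Un)
  moreover have "shallow \<union> (closure A \<union> closure B) = UNIV"
    using AB(1) closure_subset[of A] closure_subset[of B] by blast
  ultimately show ?thesis by simp
qed

text \<open>If \<open>{x..z}\<close> misses \<open>shallow\<close>, connectedness keeps it in one
  component. Otherwise the comparison passes through a point of \<open>shallow\<close>, and from
  there through the endpoint of any component that is entered.\<close>

lemma slope_mono:
  assumes "x \<le> z"
  shows "slope x \<le> slope z"
proof -
  have within: "slope u \<le> slope v" if "u \<in> shallow" "v \<in> shallow" "u \<le> v" for u v
    using that g_mono by (simp add: slope_def)
  have right: "slope u \<le> slope v" if uv: "u \<in> shallow" "u \<le> v" for u v
  proof (cases "v \<in> shallow")
    case False
    then obtain I where I: "I \<in> components (- shallow)" "v \<in> I" by (rule component_of_steep)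
    obtain d where d: "d \<in> shallow"
      "(\<forall>x\<in>I. \<forall>z\<in>shallow. x < d \<and> d \<le> z) \<or> (\<forall>x\<in>I. \<forall>z\<in>shallow. z \<le> d \<and> d < x)"
      "\<And>x z. x \<in> insert d I \<Longrightarrow> z \<in> insert d I \<Longrightarrow> x \<le> z \<Longrightarrow> slope x \<le> slope z"
      using glued_component[OF I(1)] by metis
    \<comment> \<open>A component to the left of \<open>shallow\<close> would give
      \<open>v < u\<close>, so only the second alternative remains.\<close>
    then have "u \<le> d" "d \<le> v" using I(2) uv by force+
    then show ?thesis using within[OF uv(1) d(1)] d(3)[of d v] I(2) by auto
  qed (use uv within in blast)
  have left: "slope u \<le> slope v" if uv: "v \<in> shallow" "u \<le> v" for u v
  proof (cases "u \<in> shallow")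
    case False
    then obtain I where I: "I \<in> components (- shallow)" "u \<in> I" by (rule component_of_steep)
    obtain d where d: "d \<in> shallow"
      "(\<forall>x\<in>I. \<forall>z\<in>shallow. x < d \<and> d \<le> z) \<or> (\<forall>x\<in>I. \<forall>z\<in>shallow. z \<le> d \<and> d < x)"
      "\<And>x z. x \<in> insert d I \<Longrightarrow> z \<in> insert d I \<Longrightarrow> x \<le> z \<Longrightarrow> slope x \<le> slope z"
      using glued_component[OF I(1)] by metis
    then have "u \<le> d" "d \<le> v" using I(2) uv by force+
    then show ?thesis using within[OF d(1) uv(1)] d(3)[of u d] I(2) by auto
  qed (use uv within in blast)
  show ?thesis
  proof (cases "{x..z} \<subseteq> - shallow")
    case True
    then have "x \<notin> shallow" using assms by auto
    then obtain I where I: "I \<in> components (- shallow)" "x \<in> I" by (rule component_of_steep)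
    then have "{x..z} \<subseteq> I"
      using components_maximal[OF I(1) connected_Icc True] assms by fastforce
    then have "z \<in> I" using assms by auto
    then show ?thesis using I glued_component[OF I(1)] assms by (metis insertCI)
  next
    case False
    then obtain c where "c \<in> shallow" "x \<le> c" "c \<le> z" by auto
    then show ?thesis using left right by (meson order.trans)
  qed
qed

lemma glued_convex: "convex_on UNIV y"
  by (rule convex_on_realI[where f' = slope]) (use glued_deriv slope_mono in auto)

lemma glued_pos_iff: "y x > 0 \<longleftrightarrow> f x > 0"
  using glued_pos[of x] y_shallow[of x] nonpos_subset_shallow by (cases "x \<in> shallow") force+

text \<open>Differentiability of \<open>y\<close> forces \<open>s = slope\<close>, so the projector
  does not depend on the selection. The ratio \<open>y / slope\<close> is \<open>f / g\<close> on
  \<open>shallow\<close> and \<open>step\<close> by construction elsewhere.\<close>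

lemma subgradient_projector_glued:
  assumes "subgradient_selection y s"
  shows "subgradient_projector y s x = (if f x > 0 then x - step x else x)"
proof -
  have "s x = slope x"
    using assms subdifferential_eq_derivative[OF glued_deriv]
    by (simp add: subgradient_selection_def)
  moreover have "y x / \<bar>slope x\<bar>\<^sup>2 * slope x = step x" if "f x > 0"
  proof (cases "x \<in> shallow")
    case True
    then show ?thesis using g_nonzero[OF that] y_shallow[OF True]
      by (simp add: slope_def step_def shallow_def power2_eq_square)
  next
    case False
    then show ?thesis using glued_pos[OF False] step_nonzero[OF that]
      by (simp add: slope_def power2_eq_square)
  qed
  ultimately show ?thesis by (simp add: subgradient_projector_def glued_pos_iff)
qed

lemma glued_is_subgradient_projector:
  "is_subgradient_projector_of (\<lambda>x. if f x > 0 then x - step x else x) y"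
  unfolding is_subgradient_projector_of_def
proof (intro conjI exI)
  show "convex_on UNIV y" by (rule glued_convex)
  show "continuous_on UNIV y"
    using glued_deriv DERIV_isCont continuous_at_imp_continuous_on by blast
  obtain x where "f x \<le> 0" using ex_nonpos by blast
  then show "{x. y x \<le> 0} \<noteq> {}" using glued_pos_iff[of x] by (auto simp: not_less[symmetric])
  show sel: "subgradient_selection y slope"
    unfolding subgradient_selection_def subdifferential_def
    using convex_on_imp_above_tangent[OF glued_convex connected_UNIV, of _ _ "slope _"] glued_deriv
    by (auto simp: algebra_simps)
  show "(\<lambda>x. if f x > 0 then x - step x else x) = subgradient_projector y slope"
    using subgradient_projector_glued[OF sel] by auto
qed

end

section \<open>The operator \<open>Z\<close> in terms of the step length, and the theorem\<close>

lemma yamagishi_yamada_eq: "yamagishi_yamada L \<rho> f x = (if f x > 0 then x - step x else x)"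
proof (cases "f x > 0")
  case True
  have grad: "grad f x = g x"
    unfolding grad_def using f_deriv[of x]
    by (intro the_equality) (auto dest: DERIV_unique)
  have "yy_theta L \<rho> f x \<le> 0 \<longleftrightarrow> excess x = 0"
    using slope_le_iff[of x] by (simp add: yy_theta_def grad)
  \<comment> \<open>Adding \<open>\<rho>\<close> back leaves \<open>(g x)\<^sup>2 / (2 * L)\<close>
    under the root, and nonzero excess means that the truncation is inactive.\<close>
  moreover have "(sqrt (yy_theta L \<rho> f x + \<rho>) - sqrt \<rho>)\<^sup>2 = (excess x)\<^sup>2" if "excess x \<noteq> 0"
    using that by (auto simp: yy_theta_def grad excess_def real_sqrt_divide max_def split: if_splits)
  ultimately show ?thesis using True g_nonzero[OF True]
    by (auto simp: yamagishi_yamada_def step_def grad power2_eq_square)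
qed (simp add: yamagishi_yamada_def)

lemma step_eq:
  "step x = (if \<bar>g x\<bar> \<le> sqrt (2 * L * \<rho>) then 1 / g x * f x
    else 1 / g x * (f x + (\<bar>g x\<bar> / sqrt (2 * L) - sqrt \<rho>)\<^sup>2))"
  using excess_eq_0_iff[of x] by (auto simp: step_def excess_def max_def)

end

text \<open>The claims \<open>deriv f x \<noteq> 0\<close> and \<open>Z x \<noteq> x\<close> ensure
  that no quotient in the formulas takes the default value of division by zero. The existence of
  \<open>q\<close> and of its limits shows that the final universal statement is not
  vacuous.\<close>

theorem theorem11p1:
  fixes f Z \<theta> :: "real \<Rightarrow> real" and L \<rho> :: real and C D :: "real set"
  assumes "convex_on UNIV f"
    and "\<forall>x. f differentiable (at x)"
    and "\<forall>x. deriv f differentiable (at x)"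
    and "C = {x. f x \<le> 0}"
    and "C \<noteq> {}"
    and "L > 0"
    and "\<rho> > 0"
    and "L-lipschitz_on UNIV (deriv f)"
    and "(INF x. ereal (f x)) \<ge> - ereal \<rho>"
    and "\<theta> = (\<lambda>x. \<bar>deriv f x\<bar>\<^sup>2 / (2 * L) - \<rho>)"
    and "Z = yamagishi_yamada L \<rho> f"
    and "D = {x. \<theta> x \<le> 0}"
  shows
    "(\<forall>x. f x > 0 \<longrightarrow> deriv f x \<noteq> 0) \<and>
     (\<forall>x. Z x =
        (if f x \<le> 0 then x
         else if \<bar>deriv f x\<bar> \<le> sqrt (2 * L * \<rho>)
           then x - 1 / deriv f x * f x
         else x - 1 / deriv f x * (f x + (\<bar>deriv f x\<bar> / sqrt (2 * L) - sqrt \<rho>)\<^sup>2))) \<and>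
     (frontier D \<subseteq> UNIV - C \<longrightarrow>
        closed D \<and> convex D \<and> C \<subseteq> D \<and>
        ((- D = {} \<and> components (- D) = {}) \<or>
         (\<exists>I. open_interval I \<and> - D = I \<and> components (- D) = {I}) \<or>
         (\<exists>I J. open_interval I \<and> open_interval J \<and> I \<inter> J = {} \<and> - D = I \<union> J \<and>
            components (- D) = {I, J})) \<and>
        (\<forall>I\<in>components (- D).
           (\<forall>x\<in>I. Z x \<noteq> x) \<and>
           (\<exists>q. \<forall>x\<in>I. (q has_real_derivative 1 / (x - Z x)) (at x)) \<and>
           (\<exists>d. closest_point D ` I = {d} \<and> frontier I \<inter> D = {d} \<and> d \<in> D - C \<and>
              (\<forall>q. (\<forall>x\<in>I. (q has_real_derivative 1 / (x - Z x)) (at x)) \<longrightarrow>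
                 (\<exists>l. (q \<longlongrightarrow> l) (at d within I))))) \<and>
        (\<forall>q d l y. yy_construction f Z D q d l y \<longrightarrow>
           convex_on UNIV y \<and>
           is_subgradient_projector_of Z y \<and>
           (\<forall>s. subgradient_selection y s \<longrightarrow> Z = subgradient_projector y s)))"
proof -
  let ?g = "deriv f"
  have ex: "\<exists>x. f x \<le> 0" using assms(4,5) by blast
  have lower: "- \<rho> \<le> f x" for x
  proof -
    have "- ereal \<rho> \<le> ereal (f x)" by (rule order.trans[OF assms(9) INF_lower]) simp
    then show ?thesis by simp
  qed
  interpret bounded_below_convex f ?g "deriv ?g" L \<rho>
    using assms(1-3,6-8) ex lower
    by unfold_locales (auto simp: DERIV_deriv_iff_real_differentiable)
  have Z: "Z = (\<lambda>x. if f x > 0 then x - step x else x)"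
    using assms(11) yamagishi_yamada_eq by auto
  have D: "D = shallow"
    using assms(10,12) slope_le_iff by (simp add: shallow_def)
  have C: "C \<subseteq> D" using assms(4) D nonpos_subset_shallow by simp
  \<comment> \<open>Off \<open>D\<close> the excess is nonzero, hence \<open>f x > 0\<close> and
    \<open>Z\<close> takes its nontrivial branch.\<close>
  have diff_Z: "x - Z x = step x" if "I \<in> components (- D)" "x \<in> I" for I x
    using f_pos_of_excess[of x] in_components_subset[OF that(1)] that(2)
    by (auto simp: Z D shallow_def)
  show ?thesis
  proof (intro conjI impI allI ballI)
    show "deriv f x \<noteq> 0" if "f x > 0" for x using g_nonzero[OF that] .
    show "Z x =
        (if f x \<le> 0 then x
         else if \<bar>deriv f x\<bar> \<le> sqrt (2 * L * \<rho>)
           then x - 1 / deriv f x * f x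
         else x - 1 / deriv f x * (f x + (\<bar>deriv f x\<bar> / sqrt (2 * L) - sqrt \<rho>)\<^sup>2))" for x
      by (auto simp: Z step_eq)
    assume "frontier D \<subseteq> UNIV - C"
    then have front: "frontier shallow \<subseteq> {x. f x > 0}" using assms(4) by (auto simp: D)
    show "closed D" "convex D" "C \<subseteq> D" using D closed_shallow convex_shallow C by auto
    obtain A B where AB: "A = {} \<or> (\<exists>d\<in>D. A = {..<d} \<and> D \<subseteq> {d..})"
      "B = {} \<or> (\<exists>d\<in>D. B = {d<..} \<and> D \<subseteq> {..d})" "- D = A \<union> B" "A \<inter> B = {}"
      "components (- D) = {A, B} - {{}}"
      using components_Compl_closed_convex_real[OF closed_shallow convex_shallow shallow_nonempty] D
      by metis
    have "open_interval A" if "A \<noteq> {}" using AB(1) that by (auto simp: open_interval_def)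
    moreover have "open_interval B" if "B \<noteq> {}" using AB(2) that by (auto simp: open_interval_def)
    moreover have "components (- D) = (if A = {} then if B = {} then {} else {B}
        else if B = {} then {A} else {A, B})" using AB(5) by auto
    ultimately show "(- D = {} \<and> components (- D) = {}) \<or>
         (\<exists>I. open_interval I \<and> - D = I \<and> components (- D) = {I}) \<or>
         (\<exists>I J. open_interval I \<and> open_interval J \<and> I \<inter> J = {} \<and> - D = I \<union> J \<and>
            components (- D) = {I, J})"
      using AB(3,4) by (cases "A = {}"; cases "B = {}") auto
    {
      fix I assume I: "I \<in> components (- D)"
      obtain d where d: "d \<in> shallow" "f d > 0" "frontier I = {d}" "closest_point shallow ` I = {d}"
        "steep_interval f ?g (deriv ?g) L \<rho> I d"
        using steep_component[OF front] I D by metis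
      interpret S: steep_interval f ?g "deriv ?g" L \<rho> I d by fact
      show "Z x \<noteq> x" if "x \<in> I" for x
        using diff_Z[OF I that] step_nonzero[OF S.f_pos[of x]] that by auto
      show "\<exists>q. \<forall>x\<in>I. (q has_real_derivative 1 / (x - Z x)) (at x)"
      proof -
        obtain P where "\<And>x. x \<in> insert d I \<Longrightarrow> (P has_real_derivative 1 / step x) (at x)"
          using S.ex_primitive by blast
        then show ?thesis using diff_Z[OF I] by (intro exI[of _ P]) simp
      qed
      show "\<exists>d. closest_point D ` I = {d} \<and> frontier I \<inter> D = {d} \<and> d \<in> D - C \<and>
              (\<forall>q. (\<forall>x\<in>I. (q has_real_derivative 1 / (x - Z x)) (at x)) \<longrightarrow>
                 (\<exists>l. (q \<longlongrightarrow> l) (at d within I)))"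
      proof (rule exI[of _ d], intro conjI allI impI)
        fix q assume "\<forall>x\<in>I. (q has_real_derivative 1 / (x - Z x)) (at x)"
        then have "\<And>x. x \<in> I \<Longrightarrow> (q has_real_derivative 1 / step x) (at x)"
          using diff_Z[OF I] by simp
        then show "\<exists>l. (q \<longlongrightarrow> l) (at d within I)"
          using S.primitive_tendsto[of q] by blast
      qed (use d D assms(4) in auto)
    }
    fix q d l y assume y: "yy_construction f Z D q d l y"
    have y_sh: "y x = f x" if "x \<in> shallow" for x
      using y that by (simp add: yy_construction_def D)
    \<comment> \<open>The families indexed by components are turned into the existential form that
      the gluing lemmas expect; \<open>d I\<close> is identified with \<open>e\<close> because both
      describe the same singleton image.\<close>
    have y_st: "\<exists>q l. (\<forall>x\<in>I. (q has_real_derivative 1 / step x) (at x)) \<and>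
        (q \<longlongrightarrow> l) (at e within I) \<and> (\<forall>x\<in>I. y x = f e / exp l * exp (q x))"
      if I: "I \<in> components (- shallow)" and e: "closest_point shallow ` I = {e}" for I e
    proof -
      have I': "I \<in> components (- D)" using I D by simp
      then have q: "\<forall>x\<in>I. (q I has_real_derivative 1 / (x - Z x)) (at x)"
        and dI: "closest_point D ` I = {d I}" and lim: "(q I \<longlongrightarrow> l I) (at (d I) within I)"
        and yI: "\<forall>x\<in>I. y x = f (d I) / exp (l I) * exp (q I x)"
        using y unfolding yy_construction_def by blast+
      have "d I = e" using dI e D by simp
      then show ?thesis using q lim yI diff_Z[OF I'] by (intro exI[of _ "q I"] exI[of _ "l I"]) simp
    qed
    note glue = front y_sh y_st
    show "convex_on UNIV y" by (rule glued_convex[OF glue])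
    show "is_subgradient_projector_of Z y"
      unfolding Z by (rule glued_is_subgradient_projector[OF glue])
    show "Z = subgradient_projector y s" if "subgradient_selection y s" for s
      unfolding Z by (rule ext) (rule subgradient_projector_glued[OF glue that, symmetric])
  qed
qed

end
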